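(* Let $n \ge d$ be positive integers. For every $n$ unit vectors $v_1, \dots, v_n \in \mathbb{R}^d$, there exist signs $\varepsilon_1, \dots, \varepsilon_n \in \{\pm 1\}$ such that \[ \lVert \varepsilon_1 v_1 + \dots + \varepsilon_n v_n \rVert \ge \sqrt{2n-d}. \]
   Context: $\lVert\cdot\rVert$ denotes the Euclidean norm on $\mathbb{R}^d$. The vectors $v_1,\dots,v_n$ are not required to be distinct. *)

theory Defs
  imports "HOL-Analysis.Analysis"
begin

end

theory Submission
  imports Defs
begin

text \<open>
  Let \<open>S x = (\<Sum>i. (x \<bullet> v i) v i)\<close> be the frame operator of the \<open>n\<close> unit vectors, with
  eigenvalues \<open>\<mu> 0 \<ge> \<mu> 1 \<ge> \<dots>\<close>. Their sum is the trace of \<open>S\<close>, which is \<open>n\<close>, so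
  \<open>\<Sum>j<d. \<mu> j - 1 = n - d\<close>. The point of the proof is that the sum of the positive terms
  \<open>\<mu> j - 1\<close> can be gained over the value \<open>n\<close> that random signs give on average.

  Rounding. If \<open>\<bar>x i\<bar> \<le> 1\<close> for all \<open>i\<close>, then independent random signs with means \<open>x i\<close> have
  expected squared norm of the signed sum equal to \<open>\<parallel>\<Sum>i. x i v i\<parallel>\<^sup>2 + (\<Sum>i. 1 - (x i)\<^sup>2)\<close>, so some
  choice of signs does at least as well (\<open>round_to_signs\<close>). It is therefore enough to find
  \<open>x\<close> in the cube with \<open>\<parallel>\<Sum>i. x i v i\<parallel>\<^sup>2 - (\<Sum>i. (x i)\<^sup>2) \<ge> n - d\<close>.

  Walk. Look for \<open>x\<close> of the form \<open>x i = g \<bullet> v i\<close>; the quantity to be made large is then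
  \<open>\<parallel>S g\<parallel>\<^sup>2 - g \<bullet> S g\<close>. Start at \<open>g = 0\<close>. Once \<open>j\<close> of the coordinates \<open>g \<bullet> v i\<close> are \<open>1\<close> or \<open>-1\<close>,
  the span of the eigenvectors for \<open>\<mu> 0, \<dots>, \<mu> j\<close> has dimension \<open>j + 1\<close> and so contains a direction
  \<open>h \<noteq> 0\<close> that keeps these coordinates fixed. On this span the form
  \<open>\<parallel>S g\<parallel>\<^sup>2 - \<mu> j (g \<bullet> S g)\<close> is nonnegative, hence convex along \<open>h\<close>, and it does not drop at one of
  the two ends of the segment that lies in the cube, where a further coordinate becomes \<open>1\<close>
  or \<open>-1\<close>. Since \<open>g \<bullet> S g = (\<Sum>i. (x i)\<^sup>2) \<ge> j + 1\<close> from then on, lowering the multiplier from \<open>\<mu> j\<close> to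
  \<open>\<mu> (j + 1)\<close> gains at least \<open>(j + 1) (\<mu> j - \<mu> (j + 1))\<close>. These gains add up by Abel
  summation: stopping when the eigenvalues drop below \<open>1\<close>, and lowering the multiplier to \<open>1\<close>, one
  has collected the sum of all positive \<open>\<mu> j - 1\<close> (\<open>spectral_walk\<close>).
\<close>

section \<open>Spectral decomposition of a self-adjoint operator\<close>

lemma linear_term_zero_if_quadratic_nonneg:
  fixes b c :: real
  assumes "\<And>t. 0 \<le> 2 * t * b + t\<^sup>2 * c"
  shows "b = 0"
proof (rule ccontr)
  assume "b \<noteq> 0"
  define t where "t = - b / (\<bar>c\<bar> + 1)"
  have "t * (\<bar>c\<bar> + 1) = - b"
    unfolding t_def by simp
  then have b: "b = - t * (\<bar>c\<bar> + 1)" by simp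
  have "t \<noteq> 0" using \<open>b \<noteq> 0\<close> b by auto
  have "2 * t * b + t\<^sup>2 * c = t\<^sup>2 * (c - 2 * \<bar>c\<bar> - 2)"
    by (simp add: b power2_eq_square algebra_simps)
  also have "\<dots> < 0"
    using \<open>t \<noteq> 0\<close> by (intro mult_pos_neg) auto
  finally show False using assms[of t] by linarith
qed

text \<open>
  At a maximum of \<open>x \<bullet> S x\<close> on the unit sphere of \<open>W\<close> the first variation
  \<open>\<nu> (w \<bullet> y) - S w \<bullet> y\<close> vanishes for every \<open>y\<close> in \<open>W\<close>; invariance of \<open>W\<close> allows \<open>y = \<nu> w - S w\<close>.
\<close>
lemma Rayleigh_maximum_is_eigenvector:
  fixes S :: "'a::euclidean_space \<Rightarrow> 'a"
  assumes lin: "linear S" and adj: "\<And>x y. S x \<bullet> y = x \<bullet> S y"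
    and sub: "subspace W" and inv: "\<And>x. x \<in> W \<Longrightarrow> S x \<in> W" and nz: "W \<noteq> {0}"
  obtains w \<nu> where "w \<in> W" "norm w = 1" "S w = \<nu> *\<^sub>R w"
    "\<And>x. x \<in> W \<Longrightarrow> x \<bullet> S x \<le> \<nu> * (x \<bullet> x)"
proof -
  let ?K = "sphere 0 1 \<inter> W"
  have "compact ?K"
    by (intro compact_Int_closed compact_sphere closed_subspace sub)
  moreover have "?K \<noteq> {}"
  proof -
    obtain x where x: "x \<in> W" "x \<noteq> 0"
      using nz subspace_0[OF sub] by auto
    then have "x /\<^sub>R norm x \<in> ?K"
      using subspace_scale[OF sub] by (simp add: divide_inverse)
    then show ?thesis by blast
  qed
  moreover have "continuous_on ?K (\<lambda>x. x \<bullet> S x)"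
    by (intro continuous_intros linear_continuous_on linear_linear[THEN iffD2] lin)
  ultimately obtain w where w: "w \<in> ?K" and max: "\<And>x. x \<in> ?K \<Longrightarrow> x \<bullet> S x \<le> w \<bullet> S w"
    using continuous_attains_sup[of ?K "\<lambda>x. x \<bullet> S x"] by blast
  define \<nu> where "\<nu> = w \<bullet> S w"
  have ww: "w \<bullet> w = 1" and wW: "w \<in> W"
    using w by (auto simp: norm_eq_1)
  have bound: "x \<bullet> S x \<le> \<nu> * (x \<bullet> x)" if "x \<in> W" for x
  proof (cases "x = 0")
    case False
    then have "x /\<^sub>R norm x \<in> ?K"
      using that subspace_scale[OF sub] by (simp add: divide_inverse)
    from max[OF this] have "(x \<bullet> S x) / (norm x)\<^sup>2 \<le> \<nu>"
      by (simp add: \<nu>_def linear_cmul[OF lin] power2_eq_square divide_inverse mult_ac)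
    then show ?thesis
      using False by (simp add: field_simps power2_norm_eq_inner)
  qed (simp add: linear_0[OF lin])
  define y where "y = \<nu> *\<^sub>R w - S w"
  have yW: "y \<in> W"
    unfolding y_def by (intro subspace_diff subspace_scale sub inv wW)
  have "0 \<le> 2 * t * (y \<bullet> y) + t\<^sup>2 * (\<nu> * (y \<bullet> y) - y \<bullet> S y)" for t
  proof -
    let ?x = "w + t *\<^sub>R y"
    have "?x \<in> W"
      by (intro subspace_add subspace_scale sub yW wW)
    from bound[OF this] have "0 \<le> \<nu> * (?x \<bullet> ?x) - ?x \<bullet> S ?x" by simp
    also have "\<dots> = \<nu> * (w \<bullet> w) - w \<bullet> S w + 2 * t * (\<nu> * (w \<bullet> y) - S w \<bullet> y)
        + t\<^sup>2 * (\<nu> * (y \<bullet> y) - y \<bullet> S y)"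
      using adj[of w y]
      by (simp add: linear_add[OF lin] linear_cmul[OF lin] inner_add_left inner_add_right
          inner_commute power2_eq_square algebra_simps)
    also have "\<nu> * (w \<bullet> w) - w \<bullet> S w = 0"
      by (simp add: ww \<nu>_def)
    also have "\<nu> * (w \<bullet> y) - S w \<bullet> y = y \<bullet> y"
      by (subst (3) y_def) (simp add: inner_diff_left)
    finally show ?thesis by simp
  qed
  then have "y \<bullet> y = 0"
    by (rule linear_term_zero_if_quadratic_nonneg)
  then have "S w = \<nu> *\<^sub>R w" by (simp add: y_def)
  with that wW ww bound show ?thesis by (metis norm_eq_1)
qed

lemma inner_sums_orthonormal:
  fixes u :: "nat \<Rightarrow> 'a::real_inner"
  assumes "\<And>i j. i < m \<Longrightarrow> j < m \<Longrightarrow> u i \<bullet> u j = (if i = j then 1 else 0)"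
  shows "(\<Sum>j<m. a j *\<^sub>R u j) \<bullet> (\<Sum>j<m. b j *\<^sub>R u j) = (\<Sum>j<m. a j * b j)"
proof -
  have "(\<Sum>j<m. a j *\<^sub>R u j) \<bullet> (\<Sum>j<m. b j *\<^sub>R u j)
      = (\<Sum>i<m. \<Sum>j<m. a i * b j * (u i \<bullet> u j))"
    by (simp only: inner_sum_left) (simp add: inner_sum_right mult_ac)
  also have "\<dots> = (\<Sum>i<m. \<Sum>j<m. if i = j then a i * b j else 0)"
    using assms by (intro sum.cong) auto
  also have "\<dots> = (\<Sum>j<m. a j * b j)"
    by simp
  finally show ?thesis .
qed

lemma orthonormal_independent:
  fixes u :: "nat \<Rightarrow> 'a::euclidean_space"
  assumes orth: "\<And>i j. i < m \<Longrightarrow> j < m \<Longrightarrow> u i \<bullet> u j = (if i = j then 1 else 0)"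
  shows "independent (u ` {..<m})" "card (u ` {..<m}) = m"
proof -
  have "pairwise orthogonal (u ` {..<m})"
    unfolding pairwise_def orthogonal_def using orth by auto
  moreover have "0 \<notin> u ` {..<m}"
    using orth by force
  ultimately show "independent (u ` {..<m})"
    by (rule pairwise_orthogonal_independent)
  have "inj_on u {..<m}"
    using orth by (intro inj_onI) (metis lessThan_iff zero_neq_one)
  then show "card (u ` {..<m}) = m"
    by (simp add: card_image)
qed

lemma orthonormal_expansion:
  fixes u :: "nat \<Rightarrow> 'a::euclidean_space"
  assumes orth: "\<And>i j. i < m \<Longrightarrow> j < m \<Longrightarrow> u i \<bullet> u j = (if i = j then 1 else 0)"
    and x: "x \<in> span (u ` {..<m})"
  shows "x = (\<Sum>j<m. (x \<bullet> u j) *\<^sub>R u j)"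
proof -
  define r where "r = x - (\<Sum>j<m. (x \<bullet> u j) *\<^sub>R u j)"
  have "r \<bullet> u i = 0" if "i < m" for i
  proof -
    have "(\<Sum>j<m. (x \<bullet> u j) * (u j \<bullet> u i)) = (\<Sum>j<m. if j = i then x \<bullet> u j else 0)"
      using orth that by (intro sum.cong) auto
    then show ?thesis
      using that by (simp add: r_def inner_diff_left inner_sum_left)
  qed
  moreover have "r \<in> span (u ` {..<m})"
    unfolding r_def by (intro span_diff x span_sum span_scale span_base) auto
  ultimately have "orthogonal r r"
    by (intro orthogonal_to_span[of r "u ` {..<m}" r]) (auto simp: orthogonal_def)
  then have "r = 0" by (simp add: orthogonal_def)
  then show ?thesis by (simp add: r_def)
qed

definition decreasing_eigensystem ::
    "('a::real_inner \<Rightarrow> 'a) \<Rightarrow> nat \<Rightarrow> (nat \<Rightarrow> 'a) \<Rightarrow> (nat \<Rightarrow> real) \<Rightarrow> bool"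
  where "decreasing_eigensystem S m u \<mu> \<longleftrightarrow>
    (\<forall>i<m. \<forall>j<m. u i \<bullet> u j = (if i = j then 1 else 0)) \<and>
    (\<forall>i<m. S (u i) = \<mu> i *\<^sub>R u i) \<and> (\<forall>i j. i \<le> j \<longrightarrow> j < m \<longrightarrow> \<mu> j \<le> \<mu> i)"

lemma decreasing_eigensystemD:
  assumes "decreasing_eigensystem S m u \<mu>"
  shows "\<And>i j. i < m \<Longrightarrow> j < m \<Longrightarrow> u i \<bullet> u j = (if i = j then 1 else 0)"
    and "\<And>i. i < m \<Longrightarrow> S (u i) = \<mu> i *\<^sub>R u i"
    and "\<And>i j. i \<le> j \<Longrightarrow> j < m \<Longrightarrow> \<mu> j \<le> \<mu> i"
  using assms by (auto simp: decreasing_eigensystem_def)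

text \<open>
  Each eigenvector maximizes the Rayleigh quotient on the orthogonal complement of the earlier
  ones. The last conjunct carries the induction: it bounds the next maximum by all earlier
  eigenvalues, which gives their order.
\<close>
lemma spectral_decomposition_decreasing:
  fixes S :: "'a::euclidean_space \<Rightarrow> 'a"
  assumes lin: "linear S" and adj: "\<And>x y. S x \<bullet> y = x \<bullet> S y"
    and "m \<le> DIM('a)"
  shows "\<exists>u \<mu>. decreasing_eigensystem S m u \<mu> \<and>
    (\<forall>i<m. \<forall>x. (\<forall>j<m. x \<bullet> u j = 0) \<longrightarrow> x \<bullet> S x \<le> \<mu> i * (x \<bullet> x))"
  using \<open>m \<le> DIM('a)\<close>
proof (induction m)
  case 0
  show ?case by (simp add: decreasing_eigensystem_def)
next
  case (Suc m)
  then have "m \<le> DIM('a)" by simp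
  from Suc.IH[OF this] obtain u \<mu> where sys: "decreasing_eigensystem S m u \<mu>"
    and ray': "\<forall>i<m. \<forall>x. (\<forall>j<m. x \<bullet> u j = 0) \<longrightarrow> x \<bullet> S x \<le> \<mu> i * (x \<bullet> x)"
    by (elim exE conjE)
  note orth = decreasing_eigensystemD(1)[OF sys] and eig = decreasing_eigensystemD(2)[OF sys]
    and dec = decreasing_eigensystemD(3)[OF sys]
  have ray: "x \<bullet> S x \<le> \<mu> i * (x \<bullet> x)" if "i < m" "\<And>j. j < m \<Longrightarrow> x \<bullet> u j = 0" for i x
    using ray' that by simp
  define W where "W = {x. \<forall>j<m. x \<bullet> u j = 0}"
  have sub: "subspace W"
    unfolding W_def by (simp add: subspace_def inner_add_left)
  have inv: "S x \<in> W" if "x \<in> W" for x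
    using that by (simp add: W_def adj eig)
  have "W \<noteq> {0}"
  proof -
    have "dim (u ` {..<m}) < DIM('a)"
      using dim_le_card'[of "u ` {..<m}"] card_image_le[of "{..<m}" u] Suc.prems by simp
    then have "span (u ` {..<m}) \<subset> span UNIV"
      by (metis dim_UNIV dim_span less_irrefl psubsetI span_UNIV subset_UNIV)
    from orthogonal_to_subspace_exists_gen[OF this]
    obtain x where "x \<noteq> 0" "\<And>y. y \<in> span (u ` {..<m}) \<Longrightarrow> orthogonal x y"
      by blast
    then have "x \<in> W" by (simp add: W_def orthogonal_def span_base)
    with \<open>x \<noteq> 0\<close> show ?thesis by blast
  qed
  with Rayleigh_maximum_is_eigenvector[OF lin adj sub inv]
  obtain w \<nu> where w: "w \<in> W" "norm w = 1" "S w = \<nu> *\<^sub>R w"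
    and wmax: "\<And>x. x \<in> W \<Longrightarrow> x \<bullet> S x \<le> \<nu> * (x \<bullet> x)"
    by blast
  have ww: "w \<bullet> w = 1" and wu: "\<And>j. j < m \<Longrightarrow> w \<bullet> u j = 0"
    using w by (auto simp: norm_eq_1 W_def)
  have \<nu>: "\<nu> \<le> \<mu> i" if "i < m" for i
    using ray[OF that, of w] wu w(3) ww by simp
  let ?u = "u(m := w)" and ?\<mu> = "\<mu>(m := \<nu>)"
  have "\<forall>i<Suc m. \<forall>j<Suc m. ?u i \<bullet> ?u j = (if i = j then 1 else 0)"
    using orth ww wu by (auto simp: less_Suc_eq inner_commute)
  moreover have "\<forall>i<Suc m. S (?u i) = ?\<mu> i *\<^sub>R ?u i"
    using eig w(3) by (auto simp: less_Suc_eq)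
  moreover have "\<forall>i j. i \<le> j \<longrightarrow> j < Suc m \<longrightarrow> ?\<mu> j \<le> ?\<mu> i"
    using dec \<nu> by (auto simp: less_Suc_eq)
  moreover have "\<forall>i<Suc m. \<forall>x. (\<forall>j<Suc m. x \<bullet> ?u j = 0) \<longrightarrow> x \<bullet> S x \<le> ?\<mu> i * (x \<bullet> x)"
  proof (intro allI impI)
    fix i x
    assume i: "i < Suc m" and x: "\<forall>j<Suc m. x \<bullet> ?u j = 0"
    have "\<forall>j<m. x \<bullet> u j = 0"
      using x by (metis fun_upd_apply less_SucI less_irrefl)
    then show "x \<bullet> S x \<le> ?\<mu> i * (x \<bullet> x)"
      using i ray wmax[of x] by (auto simp: less_Suc_eq W_def)
  qed
  ultimately have "decreasing_eigensystem S (Suc m) ?u ?\<mu> \<and>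
      (\<forall>i<Suc m. \<forall>x. (\<forall>j<Suc m. x \<bullet> ?u j = 0) \<longrightarrow> x \<bullet> S x \<le> ?\<mu> i * (x \<bullet> x))"
    by (simp only: decreasing_eigensystem_def simp_thms)
  then show ?case by (intro exI)
qed

section \<open>Walking to the boundary of the cube\<close>

text \<open>
  From a point of the polytope \<open>\<bar>g \<bullet> v i\<bar> \<le> 1\<close> the line in direction \<open>h\<close> meets the boundary both ways.
  The number \<open>b\<close> selects the way: for a function with derivative \<open>2 b\<close> along \<open>h\<close> the
  condition \<open>0 \<le> t * b\<close> says that the linear part does not decrease. The case \<open>t = 0\<close> occurs when a
  constraint that is not constant along \<open>h\<close> is already tight.
\<close>
lemma slide_to_new_face:
  fixes g h :: "'a::real_inner" and v :: "'i \<Rightarrow> 'a" and b :: real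
  assumes fin: "finite I" and g: "\<And>i. i \<in> I \<Longrightarrow> \<bar>g \<bullet> v i\<bar> \<le> 1"
    and h: "\<exists>i\<in>I. h \<bullet> v i \<noteq> 0"
  obtains t k where "0 \<le> t * b" "k \<in> I" "h \<bullet> v k \<noteq> 0" "\<bar>(g + t *\<^sub>R h) \<bullet> v k\<bar> = 1"
    "\<And>i. i \<in> I \<Longrightarrow> \<bar>(g + t *\<^sub>R h) \<bullet> v i\<bar> \<le> 1"
proof -
  define s :: real where "s = (if 0 \<le> b then 1 else - 1)"
  define f where "f i = s * (h \<bullet> v i)" for i
  define J where "J = {i \<in> I. h \<bullet> v i \<noteq> 0}"
  \<comment> \<open>the time at which constraint \<open>i\<close> becomes tight when moving in direction \<open>s h\<close>\<close>
  define \<tau> where "\<tau> i = (1 - sgn (f i) * (g \<bullet> v i)) / \<bar>f i\<bar>" for i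
  have "finite J" "J \<noteq> {}"
    using fin h by (auto simp: J_def)
  then obtain k where k: "k \<in> J" and min: "\<And>i. i \<in> J \<Longrightarrow> \<tau> k \<le> \<tau> i"
    using arg_min_if_finite(1)[of J \<tau>] arg_min_least[of J _ \<tau>] by blast
  have f0: "f i \<noteq> 0" if "i \<in> J" for i
    using that by (auto simp: J_def f_def s_def)
  have sg: "\<bar>sgn (f i) * (g \<bullet> v i)\<bar> \<le> 1" if "i \<in> J" for i
    using that g[of i] f0[of i] by (auto simp: J_def abs_mult abs_sgn_eq)
  have \<tau>0: "0 \<le> \<tau> k"
    using sg[OF k] by (auto simp: \<tau>_def)
  have eq: "sgn (f i) * ((g + (\<tau> k * s) *\<^sub>R h) \<bullet> v i) = sgn (f i) * (g \<bullet> v i) + \<tau> k * \<bar>f i\<bar>" for i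
    by (simp add: inner_add_left f_def algebra_simps abs_sgn)
  have ab: "\<bar>(g + (\<tau> k * s) *\<^sub>R h) \<bullet> v i\<bar> = \<bar>sgn (f i) * (g \<bullet> v i) + \<tau> k * \<bar>f i\<bar>\<bar>" if "i \<in> J" for i
    using f0[OF that] by (simp add: eq[symmetric] abs_mult abs_sgn_eq)
  show ?thesis
  proof (rule that[of "\<tau> k * s" k])
    show "0 \<le> \<tau> k * s * b"
      using \<tau>0 by (auto simp: s_def mult_nonneg_nonpos)
    show "k \<in> I" "h \<bullet> v k \<noteq> 0" using k by (auto simp: J_def)
    show "\<bar>(g + (\<tau> k * s) *\<^sub>R h) \<bullet> v k\<bar> = 1"
    proof -
      have "\<tau> k * \<bar>f k\<bar> = 1 - sgn (f k) * (g \<bullet> v k)"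
        using f0[OF k] by (simp add: \<tau>_def)
      then show ?thesis by (simp only: ab[OF k])
    qed
    show "\<bar>(g + (\<tau> k * s) *\<^sub>R h) \<bullet> v i\<bar> \<le> 1" if "i \<in> I" for i
    proof (cases "i \<in> J")
      case True
      have "\<tau> k * \<bar>f i\<bar> \<le> \<tau> i * \<bar>f i\<bar>"
        by (intro mult_right_mono min True) simp
      also have "\<dots> = 1 - sgn (f i) * (g \<bullet> v i)"
        using f0[OF True] by (simp add: \<tau>_def)
      finally have "sgn (f i) * (g \<bullet> v i) + \<tau> k * \<bar>f i\<bar> \<le> 1" by simp
      moreover have "- 1 \<le> sgn (f i) * (g \<bullet> v i) + \<tau> k * \<bar>f i\<bar>"
        using sg[OF True] \<tau>0 by (smt (verit) mult_nonneg_nonneg abs_ge_zero)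
      ultimately show ?thesis
        by (simp add: ab[OF True] abs_le_iff)
    next
      case False
      then show ?thesis using g[OF that] that by (simp add: J_def inner_add_left)
    qed
  qed
qed

text \<open>
  The vectors \<open>v i\<close> may lie outside the span, so they are first replaced by their projections, which
  have the same inner products with its elements.
\<close>
lemma exists_in_span_orthogonal_to_few:
  fixes u :: "nat \<Rightarrow> 'a::euclidean_space" and v :: "'i \<Rightarrow> 'a"
  assumes orth: "\<And>i j. i < m \<Longrightarrow> j < m \<Longrightarrow> u i \<bullet> u j = (if i = j then 1 else 0)"
    and A: "finite A" "card A < m"
  obtains h where "h \<noteq> 0" "h \<in> span (u ` {..<m})" "\<And>i. i \<in> A \<Longrightarrow> h \<bullet> v i = 0"
proof -
  define p where "p i = (\<Sum>j<m. (v i \<bullet> u j) *\<^sub>R u j)" for i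
  have "p ` A \<subseteq> span (u ` {..<m})"
    unfolding p_def by (intro image_subsetI span_sum span_scale span_base) auto
  then have "span (p ` A) \<subseteq> span (u ` {..<m})"
    by (simp add: span_minimal)
  moreover have "dim (p ` A) < dim (u ` {..<m})"
    using dim_le_card'[of "p ` A"] card_image_le[of A p] A
      orthonormal_independent[OF orth] by (simp add: dim_eq_card_independent)
  ultimately have "span (p ` A) \<subset> span (u ` {..<m})"
    by (metis dim_span less_irrefl psubsetI)
  from orthogonal_to_subspace_exists_gen[OF this]
  obtain h where h: "h \<noteq> 0" "h \<in> span (u ` {..<m})"
    and ho: "\<And>y. y \<in> span (p ` A) \<Longrightarrow> orthogonal h y"
    by blast
  have "h \<bullet> v i = 0" if "i \<in> A" for i
  proof -
    have "h \<bullet> v i = (\<Sum>j<m. (h \<bullet> u j) *\<^sub>R u j) \<bullet> v i"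
      using orthonormal_expansion[OF orth h(2)] by simp
    also have "\<dots> = h \<bullet> p i"
      by (simp add: p_def inner_sum_left inner_sum_right inner_commute mult_ac)
    also have "\<dots> = 0"
      using ho[of "p i"] that by (simp add: span_base orthogonal_def)
    finally show ?thesis .
  qed
  with h that show ?thesis by blast
qed

definition frame_op :: "'i set \<Rightarrow> ('i \<Rightarrow> 'a::real_inner) \<Rightarrow> 'a \<Rightarrow> 'a"
  where "frame_op I v x = (\<Sum>i\<in>I. (x \<bullet> v i) *\<^sub>R v i)"

lemma linear_frame_op: "linear (frame_op I v)"
  by (rule linearI)
    (simp_all add: frame_op_def inner_add_left scaleR_add_left sum.distrib scaleR_sum_right)

lemma frame_op_inner: "frame_op I v x \<bullet> y = (\<Sum>i\<in>I. (x \<bullet> v i) * (y \<bullet> v i))"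
  by (simp add: frame_op_def inner_sum_left inner_commute[of y])

lemma frame_op_adjoint: "frame_op I v x \<bullet> y = x \<bullet> frame_op I v y"
  by (simp add: frame_op_inner inner_commute[of x] mult.commute)

text \<open>
  The number \<open>m\<close> counts the steps of the walk, \<open>A\<close> collects the coordinates that have
  become \<open>1\<close> or \<open>-1\<close>, and \<open>c\<close> is the multiplier of \<open>g \<bullet> S g\<close>. The bound is
  stated for every \<open>c\<close> below the eigenvalues in use, because the next step needs it for the
  eigenvalue \<open>\<mu> m\<close> and the conclusion needs it for \<open>c = 1\<close>. Lowering \<open>c\<close> raises the
  right-hand side at rate \<open>g \<bullet> S g\<close>, which is at least \<open>card A = m\<close>, the rate of the left-hand side.
\<close>
lemma spectral_walk:
  fixes v :: "'i \<Rightarrow> 'a::euclidean_space"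
  assumes fin: "finite I"
    and sys: "decreasing_eigensystem (frame_op I v) m u \<mu>"
    and pos: "\<And>i. i < m \<Longrightarrow> 0 < \<mu> i"
  shows "\<exists>g A. A \<subseteq> I \<and> card A = m \<and> (\<forall>i\<in>I. \<bar>g \<bullet> v i\<bar> \<le> 1) \<and> (\<forall>i\<in>A. \<bar>g \<bullet> v i\<bar> = 1) \<and>
    (\<forall>c. (\<forall>j<m. c \<le> \<mu> j) \<longrightarrow>
      (\<Sum>j<m. \<mu> j - c) \<le> (norm (frame_op I v g))\<^sup>2 - c * (\<Sum>i\<in>I. (g \<bullet> v i)\<^sup>2))"
  using sys pos
proof (induction m)
  case 0
  show ?case
    by (rule exI[of _ 0], rule exI[of _ "{}"]) (simp add: frame_op_def)
next
  case (Suc m)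
  note orth = decreasing_eigensystemD(1)[OF Suc.prems(1)]
    and eig = decreasing_eigensystemD(2)[OF Suc.prems(1)]
    and dec = decreasing_eigensystemD(3)[OF Suc.prems(1)] and pos = Suc.prems(2)
  let ?S = "frame_op I v"
  have "decreasing_eigensystem ?S m u \<mu>"
    unfolding decreasing_eigensystem_def using orth eig dec by simp
  then have "\<exists>g A. A \<subseteq> I \<and> card A = m \<and> (\<forall>i\<in>I. \<bar>g \<bullet> v i\<bar> \<le> 1) \<and> (\<forall>i\<in>A. \<bar>g \<bullet> v i\<bar> = 1) \<and>
    (\<forall>c. (\<forall>j<m. c \<le> \<mu> j) \<longrightarrow>
      (\<Sum>j<m. \<mu> j - c) \<le> (norm (frame_op I v g))\<^sup>2 - c * (\<Sum>i\<in>I. (g \<bullet> v i)\<^sup>2))"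
    using pos by (intro Suc.IH) auto
  then obtain g A where A: "A \<subseteq> I" "card A = m" and gI: "\<And>i. i \<in> I \<Longrightarrow> \<bar>g \<bullet> v i\<bar> \<le> 1"
    and gA: "\<And>i. i \<in> A \<Longrightarrow> \<bar>g \<bullet> v i\<bar> = 1"
    and gq: "\<And>c. (\<And>j. j < m \<Longrightarrow> c \<le> \<mu> j) \<Longrightarrow>
      (\<Sum>j<m. \<mu> j - c) \<le> (norm (?S g))\<^sup>2 - c * (\<Sum>i\<in>I. (g \<bullet> v i)\<^sup>2)"
    by blast
  have finA: "finite A" using A fin finite_subset by blast
  obtain h where h: "h \<noteq> 0" "h \<in> span (u ` {..<Suc m})" "\<And>i. i \<in> A \<Longrightarrow> h \<bullet> v i = 0"
    using exists_in_span_orthogonal_to_few[OF orth finA] A by (metis lessI)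
  define a where "a j = h \<bullet> u j" for j
  have h_eq: "h = (\<Sum>j<Suc m. a j *\<^sub>R u j)"
    unfolding a_def by (rule orthonormal_expansion[OF orth h(2)])
  have Sh_eq: "?S h = (\<Sum>j<Suc m. (\<mu> j * a j) *\<^sub>R u j)"
  proof -
    have "?S h = (\<Sum>j<Suc m. a j *\<^sub>R ?S (u j))"
      by (subst h_eq) (simp add: linear_sum[OF linear_frame_op] linear_cmul[OF linear_frame_op]
          linear_add[OF linear_frame_op])
    also have "\<dots> = (\<Sum>j<Suc m. (\<mu> j * a j) *\<^sub>R u j)"
      by (intro sum.cong) (auto simp: eig)
    finally show ?thesis .
  qed
  have hh: "h \<bullet> h = (\<Sum>j<Suc m. a j * a j)"
    by (subst (1 2) h_eq) (rule inner_sums_orthonormal[OF orth])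
  have hSh: "h \<bullet> ?S h = (\<Sum>j<Suc m. a j * (\<mu> j * a j))"
    by (subst Sh_eq, subst h_eq) (rule inner_sums_orthonormal[OF orth])
  have ShSh: "?S h \<bullet> ?S h = (\<Sum>j<Suc m. (\<mu> j * a j) * (\<mu> j * a j))"
    by (subst (1 2) Sh_eq) (rule inner_sums_orthonormal[OF orth])
  define c where "c = \<mu> m"
  have cle: "c \<le> \<mu> j" if "j < Suc m" for j
    using dec[of j m] that by (simp add: c_def)
  have c0: "0 < c" using pos by (simp add: c_def)
  \<comment> \<open>the second-order term of the form \<open>\<parallel>S g\<parallel>\<^sup>2 - c (g \<bullet> S g)\<close> along \<open>h\<close>\<close>
  have conv: "0 \<le> ?S h \<bullet> ?S h - c * (h \<bullet> ?S h)"
  proof -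
    have "?S h \<bullet> ?S h - c * (h \<bullet> ?S h) = (\<Sum>j<Suc m. \<mu> j * (\<mu> j - c) * (a j)\<^sup>2)"
      unfolding ShSh hSh sum_distrib_left sum_subtractf[symmetric]
      by (intro sum.cong) (auto simp: power2_eq_square algebra_simps)
    also have "\<dots> \<ge> 0"
      using cle pos by (intro sum_nonneg mult_nonneg_nonneg) (auto simp: less_imp_le)
    finally show ?thesis .
  qed
  \<comment> \<open>needed because \<open>h \<bullet> S h = 0\<close> would put the whole line in direction \<open>h\<close> inside the polytope\<close>
  have "0 < h \<bullet> ?S h"
  proof -
    have "0 < c * (h \<bullet> h)" using c0 h(1) by simp
    also have "\<dots> = (\<Sum>j<Suc m. c * (a j)\<^sup>2)"
      by (simp only: hh sum_distrib_left power2_eq_square)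
    also have "\<dots> \<le> (\<Sum>j<Suc m. \<mu> j * (a j)\<^sup>2)"
      using cle by (intro sum_mono mult_right_mono) auto
    also have "\<dots> = h \<bullet> ?S h"
      unfolding hSh by (intro sum.cong) (auto simp: power2_eq_square)
    finally show ?thesis .
  qed
  then have "(\<Sum>i\<in>I. (h \<bullet> v i) * (h \<bullet> v i)) \<noteq> 0"
    by (simp add: frame_op_inner[symmetric] inner_commute)
  then have "\<exists>i\<in>I. h \<bullet> v i \<noteq> 0"
    by (metis (no_types, lifting) mult_zero_left sum.neutral)
  from slide_to_new_face[OF fin gI this, of "?S g \<bullet> ?S h - c * (g \<bullet> ?S h)"]
  obtain t k where t: "0 \<le> t * (?S g \<bullet> ?S h - c * (g \<bullet> ?S h))"
    and k: "k \<in> I" "h \<bullet> v k \<noteq> 0" "\<bar>(g + t *\<^sub>R h) \<bullet> v k\<bar> = 1"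
    and g'I: "\<And>i. i \<in> I \<Longrightarrow> \<bar>(g + t *\<^sub>R h) \<bullet> v i\<bar> \<le> 1"
    by blast
  define g' where "g' = g + t *\<^sub>R h"
  define X where "X = (\<Sum>i\<in>I. (g' \<bullet> v i)\<^sup>2)"
  have sq: "(\<Sum>i\<in>I. (y \<bullet> v i)\<^sup>2) = y \<bullet> ?S y" for y
    by (simp add: inner_commute[of y] frame_op_inner power2_eq_square)
  have "k \<notin> A" using h(3) k(2) by blast
  then have card': "card (insert k A) = Suc m"
    using finA A(2) by simp
  have tight: "\<bar>g' \<bullet> v i\<bar> = 1" if "i \<in> insert k A" for i
    using that k(3) gA h(3) by (auto simp: g'_def inner_add_left)
  have X: "real (Suc m) \<le> X"
  proof -
    have "real (Suc m) = (\<Sum>i\<in>insert k A. (g' \<bullet> v i)\<^sup>2)"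
    proof -
      have "(g' \<bullet> v i)\<^sup>2 = 1" if "i \<in> insert k A" for i
        using tight[OF that] by (simp add: abs_square_eq_1)
      then have "(\<Sum>i\<in>insert k A. (g' \<bullet> v i)\<^sup>2) = (\<Sum>i\<in>insert k A. 1)"
        by (intro sum.cong refl)
      then show ?thesis using card' by (simp del: sum.insert)
    qed
    also have "\<dots> \<le> X"
      unfolding X_def using A k fin by (intro sum_mono2) auto
    finally show ?thesis .
  qed
  have q: "(\<Sum>j<m. \<mu> j - c) \<le> (norm (?S g'))\<^sup>2 - c * X"
  proof -
    have "(\<Sum>j<m. \<mu> j - c) \<le> ?S g \<bullet> ?S g - c * (g \<bullet> ?S g)"
      using gq[of c] cle by (simp add: sq power2_norm_eq_inner)
    also have "\<dots> \<le> ?S g \<bullet> ?S g - c * (g \<bullet> ?S g)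
        + 2 * (t * (?S g \<bullet> ?S h - c * (g \<bullet> ?S h))) + t\<^sup>2 * (?S h \<bullet> ?S h - c * (h \<bullet> ?S h))"
      using t conv by simp
    also have "\<dots> = ?S g' \<bullet> ?S g' - c * (g' \<bullet> ?S g')"
      using frame_op_adjoint[of I v g h]
      by (simp add: g'_def linear_add[OF linear_frame_op] linear_cmul[OF linear_frame_op]
          inner_add_left inner_add_right inner_commute power2_eq_square algebra_simps)
    finally show ?thesis by (simp add: X_def sq power2_norm_eq_inner)
  qed
  have "(\<Sum>j<Suc m. \<mu> j - c') \<le> (norm (?S g'))\<^sup>2 - c' * X"
    if c': "\<forall>j<Suc m. c' \<le> \<mu> j" for c'
  proof -
    have "(\<Sum>j<Suc m. \<mu> j - c') = (\<Sum>j<m. \<mu> j - c) + (c - c') * real (Suc m)"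
      by (simp add: c_def sum_subtractf algebra_simps)
    also have "\<dots> \<le> (norm (?S g'))\<^sup>2 - c * X + (c - c') * X"
      using c' by (intro add_mono q mult_left_mono X) (simp add: c_def)
    finally show ?thesis by (simp add: algebra_simps)
  qed
  with A k card' tight g'I show ?case
    unfolding X_def g'_def[symmetric]
    by (intro exI[of _ g'] exI[of _ "insert k A"]) auto
qed

section \<open>Rounding to signs\<close>

text \<open>
  As a function of a single \<open>x k\<close> the left-hand side is affine, because the term
  \<open>(x k)\<^sup>2 * (norm (v k))\<^sup>2\<close> cancels; so one of the values \<open>1\<close> and \<open>-1\<close> is at least as good. The
  offset \<open>w\<close> holds the vectors whose signs are already chosen.
\<close>
lemma round_to_signs:
  fixes v :: "'i \<Rightarrow> 'a::real_inner" and x :: "'i \<Rightarrow> real"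
  assumes "finite I" "\<And>i. i \<in> I \<Longrightarrow> \<bar>x i\<bar> \<le> 1"
  shows "\<exists>\<epsilon>. (\<forall>i\<in>I. \<epsilon> i \<in> {1, - 1}) \<and>
    (norm (w + (\<Sum>i\<in>I. x i *\<^sub>R v i)))\<^sup>2 + (\<Sum>i\<in>I. (1 - (x i)\<^sup>2) * (norm (v i))\<^sup>2)
      \<le> (norm (w + (\<Sum>i\<in>I. \<epsilon> i *\<^sub>R v i)))\<^sup>2"
  using assms
proof (induction I arbitrary: w rule: finite_induct)
  case empty
  show ?case by simp
next
  case (insert k I)
  define y where "y = w + (\<Sum>i\<in>I. x i *\<^sub>R v i)"
  define e :: real where "e = (if 0 \<le> y \<bullet> v k then 1 else - 1)"
  have e: "e \<in> {1, - 1}" by (simp add: e_def)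
  have "x k * (y \<bullet> v k) \<le> \<bar>x k\<bar> * \<bar>y \<bullet> v k\<bar>"
    by (metis abs_ge_self abs_mult)
  also have "\<dots> \<le> 1 * \<bar>y \<bullet> v k\<bar>"
    using insert.prems by (intro mult_right_mono) auto
  also have "\<dots> = e * (y \<bullet> v k)" by (simp add: e_def)
  finally have le: "x k * (y \<bullet> v k) \<le> e * (y \<bullet> v k)" .
  have ex: "(norm (y + s *\<^sub>R v k))\<^sup>2 = (norm y)\<^sup>2 + 2 * (s * (y \<bullet> v k)) + s\<^sup>2 * (norm (v k))\<^sup>2" for s
    unfolding power2_norm_eq_inner
    by (simp add: inner_add_left inner_add_right inner_commute power2_eq_square algebra_simps)
  have "e\<^sup>2 = 1" by (simp add: e_def)
  then have step: "(norm (y + x k *\<^sub>R v k))\<^sup>2 + (1 - (x k)\<^sup>2) * (norm (v k))\<^sup>2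
      \<le> (norm (y + e *\<^sub>R v k))\<^sup>2"
    using le by (simp add: ex algebra_simps)
  obtain \<epsilon> where \<epsilon>: "\<forall>i\<in>I. \<epsilon> i \<in> {1, - 1}"
    and ih: "(norm ((w + e *\<^sub>R v k) + (\<Sum>i\<in>I. x i *\<^sub>R v i)))\<^sup>2
        + (\<Sum>i\<in>I. (1 - (x i)\<^sup>2) * (norm (v i))\<^sup>2)
      \<le> (norm ((w + e *\<^sub>R v k) + (\<Sum>i\<in>I. \<epsilon> i *\<^sub>R v i)))\<^sup>2"
    using insert.IH[of "w + e *\<^sub>R v k"] insert.prems by auto
  have upd: "(\<Sum>i\<in>I. (\<epsilon>(k := e)) i *\<^sub>R v i) = (\<Sum>i\<in>I. \<epsilon> i *\<^sub>R v i)"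
    using insert.hyps by (intro sum.cong) auto
  show ?case
  proof (intro exI[of _ "\<epsilon>(k := e)"] conjI)
    show "\<forall>i\<in>insert k I. (\<epsilon>(k := e)) i \<in> {1, - 1}"
      using \<epsilon> e by auto
    show "(norm (w + (\<Sum>i\<in>insert k I. x i *\<^sub>R v i)))\<^sup>2
        + (\<Sum>i\<in>insert k I. (1 - (x i)\<^sup>2) * (norm (v i))\<^sup>2)
      \<le> (norm (w + (\<Sum>i\<in>insert k I. (\<epsilon>(k := e)) i *\<^sub>R v i)))\<^sup>2"
    proof -
      have e1: "w + (\<Sum>i\<in>insert k I. x i *\<^sub>R v i) = y + x k *\<^sub>R v k"
        using insert.hyps by (simp add: y_def)
      have e2: "(w + e *\<^sub>R v k) + (\<Sum>i\<in>I. x i *\<^sub>R v i) = y + e *\<^sub>R v k"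
        by (simp add: y_def)
      have e3: "w + (\<Sum>i\<in>insert k I. (\<epsilon>(k := e)) i *\<^sub>R v i)
          = (w + e *\<^sub>R v k) + (\<Sum>i\<in>I. \<epsilon> i *\<^sub>R v i)"
        using insert.hyps upd by simp
      have e4: "(\<Sum>i\<in>insert k I. (1 - (x i)\<^sup>2) * (norm (v i))\<^sup>2)
          = (1 - (x k)\<^sup>2) * (norm (v k))\<^sup>2 + (\<Sum>i\<in>I. (1 - (x i)\<^sup>2) * (norm (v i))\<^sup>2)"
        using insert.hyps by simp
      show ?thesis
        unfolding e1 e3 e4 using step ih[unfolded e2] by linarith
    qed
  qed
qed

section \<open>Signed sums of unit vectors\<close>

text \<open>
  The walk is run for the eigenvalues that are at least \<open>1\<close>. The others have \<open>\<mu> j - 1 \<le> 0\<close>, so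
  leaving them out can only increase \<open>\<Sum>j. \<mu> j - 1 = card I - DIM('a)\<close>.
\<close>
lemma signed_sum_of_unit_vectors:
  fixes v :: "'i \<Rightarrow> 'a::euclidean_space"
  assumes fin: "finite I" and unit: "\<And>i. i \<in> I \<Longrightarrow> norm (v i) = 1"
  shows "\<exists>\<epsilon>. (\<forall>i\<in>I. \<epsilon> i \<in> {1, - 1}) \<and>
    2 * real (card I) - real DIM('a) \<le> (norm (\<Sum>i\<in>I. \<epsilon> i *\<^sub>R v i))\<^sup>2"
proof -
  let ?d = "DIM('a)" and ?S = "frame_op I v"
  obtain u \<mu> where sys: "decreasing_eigensystem ?S ?d u \<mu>"
    using spectral_decomposition_decreasing[OF linear_frame_op frame_op_adjoint order_refl, of I v]
    by blast
  note orth = decreasing_eigensystemD(1)[OF sys] and eig = decreasing_eigensystemD(2)[OF sys]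
    and dec = decreasing_eigensystemD(3)[OF sys]
  have "span (u ` {..<?d}) = UNIV"
    using orthonormal_independent[OF orth] by (metis dim_UNIV dim_eq_full dim_eq_card_independent)
  then have x_eq: "x = (\<Sum>j<?d. (x \<bullet> u j) *\<^sub>R u j)" for x
    by (intro orthonormal_expansion orth) auto
  have parseval: "(\<Sum>j<?d. (x \<bullet> u j)\<^sup>2) = (norm x)\<^sup>2" for x
  proof -
    have "x \<bullet> x = (\<Sum>j<?d. (x \<bullet> u j) * (x \<bullet> u j))"
      by (subst (1 2) x_eq) (rule inner_sums_orthonormal[OF orth])
    then show ?thesis
      unfolding power2_norm_eq_inner by (simp add: power2_eq_square)
  qed
  have trace: "(\<Sum>j<?d. \<mu> j) = real (card I)"
  proof -
    have "\<mu> j = (\<Sum>i\<in>I. (v i \<bullet> u j)\<^sup>2)" if "j < ?d" for j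
    proof -
      have "\<mu> j = ?S (u j) \<bullet> u j" using eig orth that by simp
      then show ?thesis
        by (simp only: frame_op_inner power2_eq_square inner_commute[of "v _"])
    qed
    then have "(\<Sum>j<?d. \<mu> j) = (\<Sum>j<?d. \<Sum>i\<in>I. (v i \<bullet> u j)\<^sup>2)" by simp
    also have "\<dots> = (\<Sum>i\<in>I. (norm (v i))\<^sup>2)"
      by (subst sum.swap) (simp add: parseval)
    also have "\<dots> = real (card I)" using unit by simp
    finally show ?thesis .
  qed
  define m where "m = (LEAST j. j = ?d \<or> \<mu> j < 1)"
  have m: "m = ?d \<or> \<mu> m < 1"
    unfolding m_def by (rule LeastI[of _ ?d]) simp
  have md: "m \<le> ?d"
    unfolding m_def by (rule Least_le) simp
  have below: "1 \<le> \<mu> j" if "j < m" for j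
    using not_less_Least[OF that[unfolded m_def]] by simp
  have above: "\<mu> j \<le> 1" if "m \<le> j" "j < ?d" for j
    using m dec[OF that] that by linarith
  have "\<exists>g A. A \<subseteq> I \<and> card A = m \<and> (\<forall>i\<in>I. \<bar>g \<bullet> v i\<bar> \<le> 1) \<and> (\<forall>i\<in>A. \<bar>g \<bullet> v i\<bar> = 1) \<and>
    (\<forall>c. (\<forall>j<m. c \<le> \<mu> j) \<longrightarrow>
      (\<Sum>j<m. \<mu> j - c) \<le> (norm (?S g))\<^sup>2 - c * (\<Sum>i\<in>I. (g \<bullet> v i)\<^sup>2))"
  proof (rule spectral_walk[OF fin])
    show "decreasing_eigensystem ?S m u \<mu>"
      unfolding decreasing_eigensystem_def using orth eig dec md by simp
    show "0 < \<mu> i" if "i < m" for i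
      using below[OF that] by simp
  qed
  then obtain g where gI: "\<And>i. i \<in> I \<Longrightarrow> \<bar>g \<bullet> v i\<bar> \<le> 1"
    and gq: "\<And>c. \<forall>j<m. c \<le> \<mu> j \<Longrightarrow>
      (\<Sum>j<m. \<mu> j - c) \<le> (norm (?S g))\<^sup>2 - c * (\<Sum>i\<in>I. (g \<bullet> v i)\<^sup>2)"
    by blast
  have g: "(\<Sum>j<m. \<mu> j - 1) \<le> (norm (?S g))\<^sup>2 - (\<Sum>i\<in>I. (g \<bullet> v i)\<^sup>2)"
    using gq[of 1] below by simp
  obtain \<epsilon> where \<epsilon>: "\<forall>i\<in>I. \<epsilon> i \<in> {1, - 1}"
    and r: "(norm (0 + (\<Sum>i\<in>I. (g \<bullet> v i) *\<^sub>R v i)))\<^sup>2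
        + (\<Sum>i\<in>I. (1 - (g \<bullet> v i)\<^sup>2) * (norm (v i))\<^sup>2)
      \<le> (norm (0 + (\<Sum>i\<in>I. \<epsilon> i *\<^sub>R v i)))\<^sup>2"
    using round_to_signs[where x = "\<lambda>i. g \<bullet> v i" and w = 0 and v = v, OF fin gI] by blast
  have "real (card I) - real ?d = (\<Sum>j<?d. \<mu> j - 1)"
    by (simp add: sum_subtractf trace)
  also have "\<dots> = (\<Sum>j<m. \<mu> j - 1) + (\<Sum>j=m..<?d. \<mu> j - 1)"
    using md by (simp add: sum.atLeastLessThan_concat lessThan_atLeast0)
  also have "\<dots> \<le> (\<Sum>j<m. \<mu> j - 1)"
  proof -
    have "(\<Sum>j=m..<?d. \<mu> j - 1) \<le> 0"
      by (rule sum_nonpos) (use above in auto)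
    then show ?thesis by simp
  qed
  also have "\<dots> \<le> (norm (?S g))\<^sup>2 - (\<Sum>i\<in>I. (g \<bullet> v i)\<^sup>2)" by (rule g)
  finally have "2 * real (card I) - real ?d
      \<le> (norm (?S g))\<^sup>2 + (real (card I) - (\<Sum>i\<in>I. (g \<bullet> v i)\<^sup>2))" by simp
  also have "\<dots> = (norm (\<Sum>i\<in>I. (g \<bullet> v i) *\<^sub>R v i))\<^sup>2
      + (\<Sum>i\<in>I. (1 - (g \<bullet> v i)\<^sup>2) * (norm (v i))\<^sup>2)"
    using unit by (simp add: frame_op_def sum_subtractf)
  also have "\<dots> \<le> (norm (\<Sum>i\<in>I. \<epsilon> i *\<^sub>R v i))\<^sup>2"
    using r by simp
  finally show ?thesis using \<epsilon> by blast
qed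

theorem theorem1:
  fixes v :: "nat \<Rightarrow> real ^ 'd" and n :: nat
  assumes "CARD('d) \<le> n"
    and "\<forall>i\<in>{1..n}. norm (v i) = 1"
  shows "\<exists>\<epsilon> :: nat \<Rightarrow> real. (\<forall>i\<in>{1..n}. \<epsilon> i \<in> {1, -1}) \<and>
    norm (\<Sum>i=1..n. \<epsilon> i *\<^sub>R v i) \<ge> sqrt (2 * real n - real CARD('d))"
proof -
  obtain \<epsilon> :: "nat \<Rightarrow> real" where "\<forall>i\<in>{1..n}. \<epsilon> i \<in> {1, -1}"
    and "2 * real n - real CARD('d) \<le> (norm (\<Sum>i=1..n. \<epsilon> i *\<^sub>R v i))\<^sup>2"
    using signed_sum_of_unit_vectors[of "{1..n}" v] assms(2) by auto
  then show ?thesis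
    by (intro exI[of _ \<epsilon>]) (auto intro: real_le_lsqrt)
qed

end
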